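(* Suppose there exists $\lambda\in\mathbb C$ satisfying conditions (i)–(iv) of the context. Let $\mathfrak R$ be a linear relation in $\partial\mathscr H$ and define $H_{\mathfrak R}:=H_m|_{D(H_{\mathfrak R})}$ with $$D(H_{\mathfrak R}):=\Big\{f\in D(H_m):\big((B-I^* )f,(A_m-I^* )f\big)\in\mathfrak R\Big\}.$$ If $\mathfrak R$ is symmetric, then $H_{\mathfrak R}$ is symmetric. If moreover there exists a real $\lambda$ satisfying conditions (i)–(iv) such that the relation $\mathfrak R-S_\lambda$ is one-to-one and $\mathrm{rg}(F_\lambda^* )\subset\mathrm{rg}(\mathfrak R-S_\lambda)$, then $H_{\mathfrak R}$ is self-adjoint, $\lambda\in\rho(H_{\mathfrak R})$, and the resolvent is given by $$R(\lambda,H_{\mathfrak R})=\Big(\mathrm{Id}+F_\lambda(\mathfrak R-S_\lambda)^{-1}(A_m-I^* )\Big)R(\lambda,H_{\mathrm{IBC}}^{0,1}).$$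
   Context: **General conventions.** For a densely defined operator $S$, $\rho(S)$ is the set of $z\in\mathbb C$ such that $z-S:D(S)\to$ (whole space) is bijective with bounded inverse, and $R(z,S):=(z-S)^{-1}$. Products of operators have their natural domain. An operator $S$ is relatively bounded with respect to an operator $R$ with bound $a$ if $D(R)\subset D(S)$ and there is $b\ge 0$ with $\|Sf\|\le a\|Rf\|+b\|f\|$ for all $f\in D(R)$. **Setting.** $\mathscr H$ and $\partial\mathscr H$ are complex Hilbert spaces; $L_m:D(L_m)\subset\mathscr H\to\mathscr H$ is a densely defined linear operator; $B:D(L_m)\to\partial\mathscr H$ and $A_m:D(A_m)\subset\mathscr H\to\partial\mathscr H$ are linear operators; $I:\partial\mathscr H\to\mathscr H$ is a bounded linear operator. Put $L:=L_m|_{\ker B}$ (so $D(L)=\ker B$) and $A:=A_m|_{\ker B}$. Standing assumptions: (a) $L$ is self-adjoint; (b) $A$ is relatively $L$-bounded (in particular $D(L)\subset D(A_m)$); (c) for $\lambda\in\rho(L)$, $\mathrm{rg}\big((AR(\lambda,L))^*\big)\subseteq\ker(\bar\lambda-L_m)$; (d) for $\lambda\in\rho(L)$, $B(AR(\lambda,L))^*=\mathrm{Id}_{\partial\mathscr H}$. For $\lambda\in\rho(L)$ define $G_\lambda:=(AR(\bar\lambda,L))^*\in\mathcal L(\partial\mathscr H,\mathscr H)$ and $T_\lambda:=A_mG_\lambda$ with $D(T_\lambda)=\{\varphi\in\partial\mathscr H: G_\lambda\varphi\in D(A_m)\}$; this domain does not depend on $\lambda$ and is denoted $D(T)$. Further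 standing assumption: $T_\lambda$ is densely defined and $T_{\bar\lambda}\subset T_\lambda^*$ for all $\lambda\in\rho(L)$. **Operators.** $H_{\mathrm{IBC}}^{0,1}f:=L_mf+IA_mf$ with $D(H_{\mathrm{IBC}}^{0,1}):=\{f\in D(L_m)\cap D(A_m):Bf=I^*f\}$ (self-adjoint as soon as some $\lambda$ satisfies (i)–(iv) below). $H_m:=L_m+II^*+I(A_m-B)$ with $D(H_m):=D(L_m)\cap D(A_m)$. $F_\lambda$ is the restriction of $\big((A_m-I^* )R(\bar\lambda,H_{\mathrm{IBC}}^{0,1})\big)^*$ to $D(F_\lambda):=D(T)$; it maps $D(T)$ into $D(H_m)$. $S_\lambda:=(A_m-I^* )F_\lambda$ with $D(S_\lambda)=D(T)$. **Conditions on $\lambda$.** (i) $\lambda\in\rho(H_{\mathrm{IBC}}^{0,1})\cap\rho(L)$; (ii) $1\in\rho(G_\lambda I^* )\cap\rho(G_{\bar\lambda}I^* )$; (iii) for $\mu\in\{\lambda,\bar\lambda\}$, $IT_\mu I^*$ is relatively bounded with respect to $(\mathrm{Id}-G_{\bar\mu}I^* )^*(L-\mu)(\mathrm{Id}-G_\mu I^* )$ with bound $a<1$; (iv) $(1-I^*G_\lambda)^{-1}$ leaves $D(T)$ invariant. **Linear relations.** A linear relation in $\partial\mathscr H$ is a linear subspace of $\partial\mathscr H\oplus\partial\mathscr H$; operators are identified with their graphs $\{(\varphi,S\varphi)\}$. $\mathrm{rg}(\mathfrak R)=\{\eta:\exists\varphi,(\varphi,\eta)\in\mathfrak R\}$;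 $\mathfrak R-\mathfrak S=\{(\varphi,\xi-\eta):(\varphi,\xi)\in\mathfrak R,(\varphi,\eta)\in\mathfrak S\}$; $\mathfrak R^{-1}=\{(\varphi,\eta):(\eta,\varphi)\in\mathfrak R\}$; $\mathfrak R^*=\{(\varphi,\eta):\langle\varphi,\xi\rangle=\langle\psi,\eta\rangle \text{ up to ordering, i.e. } \langle\varphi,\xi\rangle=\langle\eta,\psi\rangle\ \forall(\psi,\xi)\in\mathfrak R\}$. $\mathfrak R$ is symmetric if $\mathfrak R\subset\mathfrak R^*$ and self-adjoint if $\mathfrak R=\mathfrak R^*$; it is one-to-one if $(\varphi,0)\in\mathfrak R$ implies $\varphi=0$ (so that $\mathfrak R^{-1}$ is an operator on $\mathrm{rg}(\mathfrak R)$). An operator $S$ is called symmetric if its graph is a symmetric relation, i.e. $\langle Sf,g\rangle=\langle f,Sg\rangle$ for all $f,g\in D(S)$. *)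

theory Defs
  imports "HOL-Analysis.Analysis"
begin

section \<open>Complex Hilbert spaces\<close>

class complex_vector = real_vector +
  fixes scaleC :: "complex \<Rightarrow> 'a \<Rightarrow> 'a"  (infixr "*\<^sub>C" 75)
  assumes scaleC_add_right: "c *\<^sub>C (x + y) = c *\<^sub>C x + c *\<^sub>C y"
    and scaleC_add_left: "(c + d) *\<^sub>C x = c *\<^sub>C x + d *\<^sub>C x"
    and scaleC_scaleC: "c *\<^sub>C d *\<^sub>C x = (c * d) *\<^sub>C x"
    and scaleC_one: "1 *\<^sub>C x = x"
    and scaleR_scaleC: "r *\<^sub>R x = complex_of_real r *\<^sub>C x"

text \<open>The inner product is conjugate-linear in its first argument.\<close>

class complex_inner = complex_vector + real_normed_vector +
  fixes cinner :: "'a \<Rightarrow> 'a \<Rightarrow> complex"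
  assumes cinner_commute: "cinner x y = cnj (cinner y x)"
    and cinner_add_right: "cinner x (y + z) = cinner x y + cinner x z"
    and cinner_scaleC_right: "cinner x (c *\<^sub>C y) = c * cinner x y"
    and cinner_ge_zero: "0 \<le> Re (cinner x x)"
    and cinner_eq_zero_iff: "cinner x x = 0 \<longleftrightarrow> x = 0"
    and norm_eq_sqrt_cinner: "norm x = sqrt (Re (cinner x x))"

class chilbert_space = complex_inner + complete_space

lemma vector_space_scaleC:
  "vector_space (scaleC :: complex \<Rightarrow> 'a::complex_vector \<Rightarrow> 'a)"
  by unfold_locales
    (auto simp: scaleC_add_right scaleC_add_left scaleC_scaleC scaleC_one)

interpretation complex_vector: vector_space
  "scaleC :: complex \<Rightarrow> 'a::complex_vector \<Rightarrow> 'a"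
  by (rule vector_space_scaleC)

instantiation complex :: chilbert_space
begin
definition scaleC_complex :: "complex \<Rightarrow> complex \<Rightarrow> complex"
  where "scaleC_complex c x = c * x"
definition cinner_complex :: "complex \<Rightarrow> complex \<Rightarrow> complex"
  where "cinner_complex x y = cnj x * y"
instance
  by standard
    (auto simp: scaleC_complex_def cinner_complex_def algebra_simps scaleR_conv_of_real
      cmod_def power2_eq_square)
end

instantiation prod :: (complex_vector, complex_vector) complex_vector
begin
definition scaleC_prod :: "complex \<Rightarrow> 'a \<times> 'b \<Rightarrow> 'a \<times> 'b"
  where "scaleC_prod c p = (c *\<^sub>C fst p, c *\<^sub>C snd p)"
instance
  by standard
    (auto simp: scaleC_prod_def scaleC_add_right scaleC_add_left scaleC_scaleC scaleC_one
      scaleR_scaleC prod_eq_iff)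
end


section \<open>Linear relations and unbounded operators\<close>

text \<open>
  Operators are identified with their graphs throughout, so that an operator from \<open>'a\<close> to \<open>'b\<close>
  is a single-valued linear relation, \<open>Domain\<close> and \<open>Range\<close> are its domain and range, \<open>Id\<close> is the
  identity operator, \<open>S\<inverse>\<close> is the inverse, \<open>S \<subseteq> T\<close> says that \<open>T\<close> extends \<open>S\<close>,
  and equality of operators includes equality of domains.
\<close>

definition linear_relation :: "('a::complex_vector \<times> 'b::complex_vector) set \<Rightarrow> bool"
  where "linear_relation R \<longleftrightarrow> complex_vector.subspace R"

definition linear_operator :: "('a::complex_vector \<times> 'b::complex_vector) set \<Rightarrow> bool"
  where "linear_operator S \<longleftrightarrow> linear_relation S \<and> single_valued S"

definition bounded_operator :: "('a::complex_inner \<times> 'b::complex_inner) set \<Rightarrow> bool"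
  where "bounded_operator S \<longleftrightarrow>
    linear_operator S \<and> Domain S = UNIV \<and> (\<exists>c. \<forall>(x, y)\<in>S. norm y \<le> c * norm x)"

definition densely_defined :: "('a::complex_inner \<times> 'b) set \<Rightarrow> bool"
  where "densely_defined S \<longleftrightarrow> closure (Domain S) = UNIV"

definition rel_plus :: "('a \<times> 'b::plus) set \<Rightarrow> ('a \<times> 'b) set \<Rightarrow> ('a \<times> 'b) set"
    (infixl "\<oplus>\<^sub>r" 65)
  where "S \<oplus>\<^sub>r T = {(x, y + z) |x y z. (x, y) \<in> S \<and> (x, z) \<in> T}"

definition rel_minus :: "('a \<times> 'b::minus) set \<Rightarrow> ('a \<times> 'b) set \<Rightarrow> ('a \<times> 'b) set"
    (infixl "\<ominus>\<^sub>r" 65)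
  where "S \<ominus>\<^sub>r T = {(x, y - z) |x y z. (x, y) \<in> S \<and> (x, z) \<in> T}"

text \<open>
  The product in operator order (first \<open>T\<close>, then \<open>S\<close>), with its natural domain; the library's
  \<open>O\<close> composes in the opposite order.
\<close>

abbreviation rel_times :: "('b \<times> 'c) set \<Rightarrow> ('a \<times> 'b) set \<Rightarrow> ('a \<times> 'c) set"
    (infixl "\<odot>\<^sub>r" 70)
  where "S \<odot>\<^sub>r T \<equiv> T O S"

definition rel_restrict :: "('a \<times> 'b) set \<Rightarrow> 'a set \<Rightarrow> ('a \<times> 'b) set"  (infixl "\<restriction>\<^sub>r" 75)
  where "S \<restriction>\<^sub>r D = {(x, y). (x, y) \<in> S \<and> x \<in> D}"

definition scalar_op :: "complex \<Rightarrow> ('a::complex_vector \<times> 'a) set"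
  where "scalar_op z = {(x, z *\<^sub>C x) |x. True}"

definition ker :: "('a \<times> 'b::zero) set \<Rightarrow> 'a set"
  where "ker S = {x. (x, 0) \<in> S}"

definition one_to_one :: "('a::zero \<times> 'b::zero) set \<Rightarrow> bool"
  where "one_to_one R \<longleftrightarrow> (\<forall>x. (x, 0) \<in> R \<longrightarrow> x = 0)"

definition adj :: "('a::complex_inner \<times> 'b::complex_inner) set \<Rightarrow> ('b \<times> 'a) set"
  where "adj R = {(y, x). \<forall>(u, v)\<in>R. cinner y v = cinner x u}"

definition symmetric_relation :: "('a::complex_inner \<times> 'a) set \<Rightarrow> bool"
  where "symmetric_relation R \<longleftrightarrow> R \<subseteq> adj R"

text \<open>
  For an operator, self-adjointness in this sense implies that the domain is dense, because
  \<open>(0, y) \<in> adj S\<close> holds exactly for the \<open>y\<close> orthogonal to \<open>Domain S\<close>.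
\<close>

definition selfadjoint_relation :: "('a::complex_inner \<times> 'a) set \<Rightarrow> bool"
  where "selfadjoint_relation R \<longleftrightarrow> R = adj R"

definition resolvent :: "complex \<Rightarrow> ('a::complex_inner \<times> 'a) set \<Rightarrow> ('a \<times> 'a) set"
  where "resolvent z S = (scalar_op z \<ominus>\<^sub>r S)\<inverse>"

definition resolvent_set :: "('a::complex_inner \<times> 'a) set \<Rightarrow> complex set"
  where "resolvent_set S = {z.
    one_to_one (scalar_op z \<ominus>\<^sub>r S) \<and> Range (scalar_op z \<ominus>\<^sub>r S) = UNIV \<and>
    bounded_operator (resolvent z S)}"

definition relatively_bounded ::
    "('a::complex_inner \<times> 'b::complex_inner) set \<Rightarrow> ('a \<times> 'c::complex_inner) set \<Rightarrow> real \<Rightarrow> bool"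
  where "relatively_bounded S R a \<longleftrightarrow> Domain R \<subseteq> Domain S \<and>
    (\<exists>b\<ge>0. \<forall>f g h. (f, g) \<in> R \<and> (f, h) \<in> S \<longrightarrow> norm h \<le> a * norm g + b * norm f)"


section \<open>The abstract boundary value setting\<close>

text \<open>
  The type variable \<open>'h\<close> stands for the Hilbert space and \<open>'d\<close> for the boundary space.
  The bounded operator \<open>I\<close> of the setting is called \<open>J\<close> here.
\<close>

definition L_op :: "('h::complex_inner \<times> 'h) set \<Rightarrow> ('h \<times> 'd::complex_inner) set \<Rightarrow> ('h \<times> 'h) set"
  where "L_op Lm B = Lm \<restriction>\<^sub>r ker B"

definition A_op ::
    "('h::complex_inner \<times> 'd::complex_inner) set \<Rightarrow> ('h \<times> 'd) set \<Rightarrow> ('h \<times> 'd) set"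
  where "A_op B Am = Am \<restriction>\<^sub>r ker B"

definition G_op ::
    "('h::complex_inner \<times> 'h) set \<Rightarrow> ('h \<times> 'd::complex_inner) set \<Rightarrow> ('h \<times> 'd) set \<Rightarrow>
      complex \<Rightarrow> ('d \<times> 'h) set"
  where "G_op Lm B Am z = adj (A_op B Am \<odot>\<^sub>r resolvent (cnj z) (L_op Lm B))"

definition T_op ::
    "('h::complex_inner \<times> 'h) set \<Rightarrow> ('h \<times> 'd::complex_inner) set \<Rightarrow> ('h \<times> 'd) set \<Rightarrow>
      complex \<Rightarrow> ('d \<times> 'd) set"
  where "T_op Lm B Am z = Am \<odot>\<^sub>r G_op Lm B Am z"

locale ibc_setting =
  fixes Lm :: "('h::chilbert_space \<times> 'h) set"
    and B :: "('h \<times> 'd::chilbert_space) set"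
    and Am :: "('h \<times> 'd) set"
    and J :: "('d \<times> 'h) set"
  assumes Lm_operator: "linear_operator Lm"
    and Lm_dense: "densely_defined Lm"
    and B_operator: "linear_operator B"
    and B_domain: "Domain B = Domain Lm"
    and Am_operator: "linear_operator Am"
    and J_bounded: "bounded_operator J"
    and L_selfadjoint: "selfadjoint_relation (L_op Lm B)"
    and A_relatively_bounded: "\<exists>a. relatively_bounded (A_op B Am) (L_op Lm B) a"
    and Range_in_kernel: "z \<in> resolvent_set (L_op Lm B) \<Longrightarrow>
      Range (adj (A_op B Am \<odot>\<^sub>r resolvent z (L_op Lm B))) \<subseteq> ker (scalar_op (cnj z) \<ominus>\<^sub>r Lm)"
    and B_right_inverse: "z \<in> resolvent_set (L_op Lm B) \<Longrightarrow>
      B \<odot>\<^sub>r adj (A_op B Am \<odot>\<^sub>r resolvent z (L_op Lm B)) = Id"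
    and T_dense: "z \<in> resolvent_set (L_op Lm B) \<Longrightarrow> densely_defined (T_op Lm B Am z)"
    and T_adjoint: "z \<in> resolvent_set (L_op Lm B) \<Longrightarrow>
      T_op Lm B Am (cnj z) \<subseteq> adj (T_op Lm B Am z)"

definition H_IBC ::
    "('h::complex_inner \<times> 'h) set \<Rightarrow> ('h \<times> 'd::complex_inner) set \<Rightarrow> ('h \<times> 'd) set \<Rightarrow>
      ('d \<times> 'h) set \<Rightarrow> ('h \<times> 'h) set"
  where "H_IBC Lm B Am J =
    (Lm \<oplus>\<^sub>r J \<odot>\<^sub>r Am) \<restriction>\<^sub>r {f. \<exists>\<phi>. (f, \<phi>) \<in> B \<and> (f, \<phi>) \<in> adj J}"

definition H_max ::
    "('h::complex_inner \<times> 'h) set \<Rightarrow> ('h \<times> 'd::complex_inner) set \<Rightarrow> ('h \<times> 'd) set \<Rightarrow>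
      ('d \<times> 'h) set \<Rightarrow> ('h \<times> 'h) set"
  where "H_max Lm B Am J = Lm \<oplus>\<^sub>r J \<odot>\<^sub>r adj J \<oplus>\<^sub>r J \<odot>\<^sub>r (Am \<ominus>\<^sub>r B)"

text \<open>
  The domain \<open>D(T)\<close> common to all \<open>T_op Lm B Am z\<close> (\<open>z\<close> in the resolvent set of \<open>L\<close>) is written
  as the domain of the one with the parameter \<open>z\<close> at hand.
\<close>

definition F_op ::
    "('h::complex_inner \<times> 'h) set \<Rightarrow> ('h \<times> 'd::complex_inner) set \<Rightarrow> ('h \<times> 'd) set \<Rightarrow>
      ('d \<times> 'h) set \<Rightarrow> complex \<Rightarrow> ('d \<times> 'h) set"
  where "F_op Lm B Am J z =
    adj ((Am \<ominus>\<^sub>r adj J) \<odot>\<^sub>r resolvent (cnj z) (H_IBC Lm B Am J)) \<restriction>\<^sub>r Domain (T_op Lm B Am z)"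

text \<open>
  \<open>F_op\<close> maps \<open>D(T)\<close> into the domain of \<open>H_max\<close>, hence into that of \<open>Am\<close>, so the natural domain
  of the following product is \<open>D(T)\<close>.
\<close>

definition S_op ::
    "('h::complex_inner \<times> 'h) set \<Rightarrow> ('h \<times> 'd::complex_inner) set \<Rightarrow> ('h \<times> 'd) set \<Rightarrow>
      ('d \<times> 'h) set \<Rightarrow> complex \<Rightarrow> ('d \<times> 'd) set"
  where "S_op Lm B Am J z = (Am \<ominus>\<^sub>r adj J) \<odot>\<^sub>r F_op Lm B Am J z"

definition H_rel ::
    "('h::complex_inner \<times> 'h) set \<Rightarrow> ('h \<times> 'd::complex_inner) set \<Rightarrow> ('h \<times> 'd) set \<Rightarrow>
      ('d \<times> 'h) set \<Rightarrow> ('d \<times> 'd) set \<Rightarrow> ('h \<times> 'h) set"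
  where "H_rel Lm B Am J R = H_max Lm B Am J \<restriction>\<^sub>r
    {f. \<exists>\<phi> \<eta>. (f, \<phi>) \<in> B \<ominus>\<^sub>r adj J \<and> (f, \<eta>) \<in> Am \<ominus>\<^sub>r adj J \<and> (\<phi>, \<eta>) \<in> R}"

definition ibc_condition ::
    "('h::complex_inner \<times> 'h) set \<Rightarrow> ('h \<times> 'd::complex_inner) set \<Rightarrow> ('h \<times> 'd) set \<Rightarrow>
      ('d \<times> 'h) set \<Rightarrow> complex \<Rightarrow> bool"
  where "ibc_condition Lm B Am J z \<longleftrightarrow>
    z \<in> resolvent_set (H_IBC Lm B Am J) \<inter> resolvent_set (L_op Lm B) \<and>
    1 \<in> resolvent_set (G_op Lm B Am z \<odot>\<^sub>r adj J) \<inter>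
        resolvent_set (G_op Lm B Am (cnj z) \<odot>\<^sub>r adj J) \<and>
    (\<forall>\<mu>\<in>{z, cnj z}. \<exists>a<1. relatively_bounded
        (J \<odot>\<^sub>r T_op Lm B Am \<mu> \<odot>\<^sub>r adj J)
        (adj (Id \<ominus>\<^sub>r G_op Lm B Am (cnj \<mu>) \<odot>\<^sub>r adj J)
          \<odot>\<^sub>r (L_op Lm B \<ominus>\<^sub>r scalar_op \<mu>)
          \<odot>\<^sub>r (Id \<ominus>\<^sub>r G_op Lm B Am \<mu> \<odot>\<^sub>r adj J)) a) \<and>
    (Id \<ominus>\<^sub>r adj J \<odot>\<^sub>r G_op Lm B Am z)\<inverse> `` Domain (T_op Lm B Am z) \<subseteq> Domain (T_op Lm B Am z)"

end

theory Submission
  imports Defs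
begin

text \<open>
  Splitting \<open>f = f\<^sub>0 + G B f\<close> with \<open>f\<^sub>0\<close> in the domain of \<open>L\<close> gives Green's identity
  \<open>\<langle>L\<^sub>m f, g\<rangle> - \<langle>f, L\<^sub>m g\<rangle> = \<langle>B f, A\<^sub>m g\<rangle> - \<langle>A\<^sub>m f, B g\<rangle>\<close>, and the extra terms of \<open>H\<^sub>m\<close> turn it into the
  same identity for \<open>H\<^sub>m\<close> with boundary maps \<open>B - I*\<close> and \<open>A\<^sub>m - I*\<close>; symmetry follows at once.
  For real \<open>\<lambda>\<close> the vector \<open>F\<^sub>\<lambda> \<phi>\<close> solves \<open>(H\<^sub>m - \<lambda>) f = 0\<close>, \<open>(B - I*) f = \<phi>\<close>, so the
  proposed resolvent formula yields a right inverse of \<open>\<lambda> - H\<close> defined on the whole space. A symmetric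
  relation with this property is self-adjoint, and Hellinger-Toeplitz makes the inverse bounded.
\<close>

section \<open>Complex Hilbert spaces\<close>

lemma cinner_add_left: "cinner (x + y) (z::'a::complex_inner) = cinner x z + cinner y z"
  by (metis cinner_add_right cinner_commute complex_cnj_add)

lemma cinner_scaleC_left: "cinner (c *\<^sub>C x) (y::'a::complex_inner) = cnj c * cinner x y"
  by (metis cinner_commute cinner_scaleC_right complex_cnj_mult)

lemma cinner_scaleR_right: "cinner x (r *\<^sub>R (y::'a::complex_inner)) = of_real r * cinner x y"
  by (simp add: scaleR_scaleC cinner_scaleC_right)

lemma cinner_scaleR_left: "cinner (r *\<^sub>R x) (y::'a::complex_inner) = of_real r * cinner x y"
  by (simp add: scaleR_scaleC cinner_scaleC_left)

lemma cinner_minus_right [simp]: "cinner x (- (y::'a::complex_inner)) = - cinner x y"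
  using cinner_scaleR_right[of x "-1" y] by simp

lemma cinner_minus_left [simp]: "cinner (- x) (y::'a::complex_inner) = - cinner x y"
  using cinner_scaleR_left[of "-1" x y] by simp

lemma cinner_diff_right: "cinner x (y - (z::'a::complex_inner)) = cinner x y - cinner x z"
  using cinner_add_right[of x y "- z"] by simp

lemma cinner_diff_left: "cinner (x - y) (z::'a::complex_inner) = cinner x z - cinner y z"
  using cinner_add_left[of x "- y" z] by simp

lemma cinner_zero_right [simp]: "cinner x (0::'a::complex_inner) = 0"
  using cinner_scaleR_right[of x 0 0] by simp

lemma cinner_zero_left [simp]: "cinner 0 (x::'a::complex_inner) = 0"
  using cinner_scaleR_left[of 0 0 x] by simp

lemmas cinner_linear = cinner_add_left cinner_add_right cinner_diff_left cinner_diff_right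
  cinner_scaleC_left cinner_scaleC_right

lemma power2_norm_eq_cinner: "(norm (x::'a::complex_inner))\<^sup>2 = Re (cinner x x)"
  by (simp add: norm_eq_sqrt_cinner cinner_ge_zero)

lemma norm_scaleC [simp]: "norm (c *\<^sub>C (x::'a::complex_inner)) = cmod c * norm x"
proof -
  have "Re (cinner (c *\<^sub>C x) (c *\<^sub>C x)) = (cmod c)\<^sup>2 * Re (cinner x x)"
    unfolding cmod_power2 by (simp add: cinner_linear algebra_simps power2_eq_square)
  then have "(norm (c *\<^sub>C x))\<^sup>2 = (cmod c * norm x)\<^sup>2"
    by (simp only: power2_norm_eq_cinner[of x] power2_norm_eq_cinner[of "c *\<^sub>C x"]
        power_mult_distrib)
  then show ?thesis
    by (simp add: power2_eq_iff_nonneg)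
qed

lemma power2_norm_add_cinner:
  "(norm (x + (y::'a::complex_inner)))\<^sup>2 = (norm x)\<^sup>2 + 2 * Re (cinner x y) + (norm y)\<^sup>2"
proof -
  have "Re (cinner y x) = Re (cinner x y)"
    by (subst cinner_commute) simp
  then show ?thesis
    by (simp add: power2_norm_eq_cinner cinner_linear)
qed

text \<open>The triangle inequality is already part of the normed structure, so squaring it and
  expanding both sides leaves exactly this bound.\<close>

lemma Re_cinner_le: "Re (cinner x y) \<le> norm x * norm (y::'a::complex_inner)"
proof -
  have "(norm (x + y))\<^sup>2 \<le> (norm x + norm y)\<^sup>2"
    by (simp add: norm_triangle_ineq power_mono)
  then show ?thesis
    by (simp add: power2_norm_add_cinner power2_sum)
qed

text \<open>Multiplying \<open>y\<close> by the conjugate phase of \<open>cinner x y\<close> makes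
  the inner product real and nonnegative and keeps the norm, which reduces the claim to real
  parts.\<close>

lemma cmod_cinner_le: "cmod (cinner x y) \<le> norm x * norm (y::'a::complex_inner)"
proof (cases "cinner x y = 0")
  case False
  have "cmod (cinner x y) = Re (cinner x (cnj (sgn (cinner x y)) *\<^sub>C y))"
    using False by (simp add: cinner_linear sgn_div_norm scaleR_conv_of_real mult.assoc
        mult.commute[of "cnj _"] complex_norm_square[symmetric] power2_eq_square)
  also have "\<dots> \<le> norm x * norm y"
    using Re_cinner_le[of x "cnj (sgn (cinner x y)) *\<^sub>C y"] False by (simp add: norm_sgn)
  finally show ?thesis .
qed simp

lemma cinner_cancel: "(\<And>u. cinner x u = cinner y u) \<Longrightarrow> x = (y::'a::complex_inner)"
  by (metis cinner_diff_left cinner_eq_zero_iff eq_iff_diff_eq_0)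

lemma continuous_on_cinner_left:
  "continuous_on UNIV (\<lambda>x::'a::complex_inner. cinner x y)"
proof -
  have "bounded_linear (\<lambda>x. cinner x y)"
    by (rule bounded_linear_intro[where K = "norm y"])
      (auto simp: cinner_add_left cinner_scaleR_left scaleR_conv_of_real cmod_cinner_le)
  then show ?thesis
    by (rule linear_continuous_on)
qed


section \<open>Riesz representation and the Hellinger-Toeplitz theorem\<close>

theorem riesz_representation:
  fixes l :: "'a::chilbert_space \<Rightarrow> complex"
  assumes add: "\<And>x y. l (x + y) = l x + l y"
    and scale: "\<And>c x. l (c *\<^sub>C x) = c * l x"
    and bound: "\<And>x. cmod (l x) \<le> K * norm x"
  shows "\<exists>y. \<forall>x. l x = cinner y x"
proof -
  \<comment> \<open>The representing vector is the minimiser of this functional.\<close>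
  define \<Phi> where "\<Phi> x = (norm x)\<^sup>2 - 2 * Re (l x)" for x
  have scaleR: "l (r *\<^sub>R x) = of_real r * l x" for r x
    by (simp add: scaleR_scaleC scale)
  have "bounded_linear l"
    by (rule bounded_linear_intro[where K = K])
      (auto simp: add scaleR scaleR_conv_of_real mult.commute[of _ K] bound)
  then have cont: "continuous_on UNIV \<Phi>"
    unfolding \<Phi>_def by (intro continuous_intros linear_continuous_on)
  have Re_l_le: "Re (l x) \<le> K * norm x" for x
    using bound[of x] complex_Re_le_cmod[of "l x"] by linarith
  \<comment> \<open>Completing the square in \<open>norm x\<close>.\<close>
  have below: "- (K\<^sup>2) \<le> \<Phi> x" for x
    using Re_l_le[of x] zero_le_power2[of "norm x - K"]
    by (simp add: \<Phi>_def power2_diff algebra_simps)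
  define m where "m = Inf (range \<Phi>)"
  have bdd: "bdd_below (range \<Phi>)"
    using below by (auto intro!: bdd_belowI)
  have m_le: "m \<le> \<Phi> x" for x
    unfolding m_def using bdd by (auto intro: cInf_lower)
  have "\<exists>x. \<Phi> x < m + 1 / real (Suc n)" for n
    using cInf_lessD[of "range \<Phi>" "m + 1 / real (Suc n)"] by (auto simp: m_def[symmetric])
  then obtain X where X: "\<Phi> (X n) < m + 1 / real (Suc n)" for n
    by metis
  \<comment> \<open>The midpoint has value at least \<open>m\<close>, so two points with values
    close to \<open>m\<close> are close to each other; this makes a minimising sequence
    Cauchy.\<close>
  have parallelogram: "(norm (x - y))\<^sup>2 = 2 * \<Phi> x + 2 * \<Phi> y - 4 * \<Phi> ((1/2) *\<^sub>R (x + y))" for x y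
  proof -
    have "4 * \<Phi> ((1/2) *\<^sub>R (x + y)) = (norm (x + y))\<^sup>2 - 4 * Re (l x) - 4 * Re (l y)"
      unfolding \<Phi>_def scaleR add norm_scaleR power_mult_distrib
      by (simp add: field_simps power2_eq_square[of "1/2"])
    then show ?thesis
      using power2_norm_add_cinner[of x y] power2_norm_add_cinner[of x "- y"]
      by (simp add: \<Phi>_def)
  qed
  have dist2: "(norm (X i - X j))\<^sup>2 \<le> 2 / real (Suc i) + 2 / real (Suc j)" for i j
    using parallelogram[of "X i" "X j"] X[of i] X[of j] m_le[of "(1/2) *\<^sub>R (X i + X j)"]
    by simp
  have "Cauchy X"
  proof (rule metric_CauchyI)
    fix e :: real assume "0 < e"
    then obtain N where N: "4 / e\<^sup>2 < real N"
      using reals_Archimedean2 by blast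
    have "dist (X i) (X j) < e" if "N \<le> i" "N \<le> j" for i j
    proof -
      have "(norm (X i - X j))\<^sup>2 \<le> 2 / real (Suc N) + 2 / real (Suc N)"
        using dist2[of i j] that
        by (smt (verit, best) frac_le of_nat_0_less_iff of_nat_le_iff Suc_le_mono zero_less_Suc)
      also have "\<dots> = 4 / real (Suc N)"
        by simp
      also have "\<dots> < e\<^sup>2"
      proof -
        have "4 / e\<^sup>2 < real (Suc N)"
          using N by simp
        then show ?thesis
          using \<open>0 < e\<close> by (simp add: field_simps del: of_nat_Suc)
      qed
      finally show ?thesis
        using \<open>0 < e\<close> by (simp add: dist_norm power_less_imp_less_base)
    qed
    then show "\<exists>N. \<forall>i\<ge>N. \<forall>j\<ge>N. dist (X i) (X j) < e"
      by blast
  qed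
  then obtain y where y: "X \<longlonglongrightarrow> y"
    using Cauchy_convergent convergent_def by blast
  have "(\<lambda>n. \<Phi> (X n)) \<longlonglongrightarrow> \<Phi> y"
    using cont y by (simp add: continuous_on_eq_continuous_at isCont_tendsto_compose)
  moreover have "(\<lambda>n. m + 1 / real (Suc n)) \<longlonglongrightarrow> m + 0"
    using LIMSEQ_inverse_real_of_nat by (intro tendsto_add tendsto_const) (simp add: divide_inverse)
  ultimately have "\<Phi> y \<le> m + 0"
    by (rule LIMSEQ_le) (use X in \<open>auto intro: less_imp_le\<close>)
  then have min: "\<Phi> y \<le> \<Phi> x" for x
    using m_le[of x] by simp
  have Re_eq: "Re (l v) = Re (cinner y v)" for v
  proof (rule ccontr)
    define d where "d = Re (cinner y v) - Re (l v)"
    assume "Re (l v) \<noteq> Re (cinner y v)"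
    then have "d \<noteq> 0" "v \<noteq> 0"
      using scale[of 0 v] by (auto simp: d_def)
    have variation: "0 \<le> t\<^sup>2 * (norm v)\<^sup>2 + 2 * t * d" for t
      using min[of "y + t *\<^sub>R v"] power2_norm_add_cinner[of y "t *\<^sub>R v"]
      by (simp add: \<Phi>_def d_def add scaleR cinner_scaleR_right power_mult_distrib algebra_simps)
    \<comment> \<open>The chosen \<open>t\<close> minimises the quadratic polynomial in
      \<open>variation\<close>; its minimum is negative unless \<open>d = 0\<close>.\<close>
    have "(- d / (norm v)\<^sup>2)\<^sup>2 * (norm v)\<^sup>2 + 2 * (- d / (norm v)\<^sup>2) * d = - (d\<^sup>2 / (norm v)\<^sup>2)"
      using \<open>v \<noteq> 0\<close> by (simp add: field_simps power2_eq_square)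
    moreover have "d\<^sup>2 / (norm v)\<^sup>2 > 0"
      using \<open>d \<noteq> 0\<close> \<open>v \<noteq> 0\<close> by simp
    ultimately show False
      using variation[of "- d / (norm v)\<^sup>2"] by linarith
  qed
  have "l v = cinner y v" for v
    \<comment> \<open>Complex linearity recovers the imaginary part from the real part at
      \<open>\<i> *\<^sub>C v\<close>.\<close>
    using Re_eq[of v] Re_eq[of "\<i> *\<^sub>C v"]
    by (simp add: scale cinner_scaleC_right complex_eq_iff)
  then show ?thesis
    by blast
qed

text \<open>Uniform boundedness by Baire's theorem: the closed sets \<open>C n\<close>, on which the
  functionals given by \<open>T u\<close> are bounded by \<open>n\<close> relative to
  \<open>norm u\<close>, cover the space because \<open>cinner x (T u) = cinner (T x) u\<close>. One
  of them contains a ball, and a bound on a ball yields a global one.\<close>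

theorem hellinger_toeplitz:
  fixes T :: "'a::chilbert_space \<Rightarrow> 'a"
  assumes sym: "\<And>x y. cinner (T x) y = cinner x (T y)"
  shows "\<exists>c. \<forall>x. norm (T x) \<le> c * norm x"
proof -
  define C where "C n = (\<Inter>u. {x. cmod (cinner x (T u)) \<le> real n * norm u})" for n
  have closed: "closed (C n)" for n
    unfolding C_def
    by (intro closed_INT ballI closed_Collect_le continuous_intros continuous_on_cinner_left)
  have cover: "x \<in> (\<Union>n. C n)" for x
  proof -
    obtain n where n: "norm (T x) \<le> real n"
      using real_arch_simple by blast
    have "cmod (cinner x (T u)) \<le> real n * norm u" for u
      using cmod_cinner_le[of "T x" u] mult_right_mono[OF n norm_ge_zero[of u]]
      by (simp add: sym)
    then show ?thesis
      by (auto simp: C_def)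
  qed
  have "\<exists>n. interior (C n) \<noteq> {}"
  proof (rule ccontr)
    assume "\<not> ?thesis"
    then have "euclidean interior_of (\<Union>(range C)) = {}"
      using closed by (intro Baire_category_alt disjI1 completely_metrizable_space_euclidean) auto
    moreover have "(\<Union>(range C)) = UNIV"
      using cover by auto
    ultimately show False
      by simp
  qed
  then obtain n x0 r where r: "0 < r" "ball x0 r \<subseteq> C n"
    by (metis all_not_in_conv mem_interior)
  \<comment> \<open>Subtracting the centre \<open>x0\<close> moves the ball to the origin and costs
    a factor 2.\<close>
  have near: "cmod (cinner y (T u)) \<le> 2 * real n * norm u" if "norm y < r" for y u
  proof -
    have "x0 + y \<in> C n" "x0 \<in> C n"
      using r that by (auto simp: subset_iff dist_norm)
    then have "cmod (cinner (x0 + y) (T u)) \<le> real n * norm u" "cmod (cinner x0 (T u)) \<le> real n * norm u"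
      by (auto simp: C_def)
    then show ?thesis
      using norm_triangle_ineq4[of "cinner (x0 + y) (T u)" "cinner x0 (T u)"]
      by (simp add: cinner_add_left)
  qed
  have far: "cmod (cinner x (T u)) \<le> (4 * real n / r * norm x) * norm u" for x u
  proof (cases "x = 0")
    case False
    \<comment> \<open>Rescaling gives \<open>x\<close> the norm \<open>r / 2\<close>, which lies
      strictly inside the ball.\<close>
    have "r / (2 * norm x) * cmod (cinner x (T u)) \<le> 2 * real n * norm u"
      using near[of "(r / (2 * norm x)) *\<^sub>R x" u] r False
      by (simp only: cinner_scaleR_left norm_mult norm_of_real) simp
    then show ?thesis
      using r False by (simp add: field_simps)
  qed simp
  have "norm (T x) \<le> (4 * real n / r) * norm x" for x
  proof -
    have "(norm (T x))\<^sup>2 \<le> cmod (cinner x (T (T x)))"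
      by (metis complex_Re_le_cmod power2_norm_eq_cinner sym)
    then have "norm (T x) * norm (T x) \<le> (4 * real n / r * norm x) * norm (T x)"
      using far[of x "T x"] by (simp add: power2_eq_square)
    then show ?thesis
      using r mult_right_le_imp_le[of "norm (T x)" "norm (T x)" "4 * real n / r * norm x"]
      by (cases "T x = 0") auto
  qed
  then show ?thesis
    by blast
qed


section \<open>Linear relations\<close>

lemma mem_rel_plus: "(x, w) \<in> S \<oplus>\<^sub>r T \<longleftrightarrow> (\<exists>y z. w = y + z \<and> (x, y) \<in> S \<and> (x, z) \<in> T)"
  by (auto simp: rel_plus_def)

lemma mem_rel_minus: "(x, w) \<in> S \<ominus>\<^sub>r T \<longleftrightarrow> (\<exists>y z. w = y - z \<and> (x, y) \<in> S \<and> (x, z) \<in> T)"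
  by (auto simp: rel_minus_def)

lemma mem_rel_restrict: "(x, y) \<in> S \<restriction>\<^sub>r D \<longleftrightarrow> (x, y) \<in> S \<and> x \<in> D"
  by (auto simp: rel_restrict_def)

lemma mem_scalar_op: "(x, y) \<in> scalar_op z \<longleftrightarrow> y = z *\<^sub>C x"
  by (auto simp: scalar_op_def)

lemma mem_adj: "(y, x) \<in> adj S \<longleftrightarrow> (\<forall>u v. (u, v) \<in> S \<longrightarrow> cinner y v = cinner x u)"
  by (auto simp: adj_def)

lemma mem_ker: "x \<in> ker S \<longleftrightarrow> (x, 0) \<in> S"
  by (auto simp: ker_def)

text \<open>Working form of the resolvent as a relation; it holds for every \<open>z\<close>, so it
  can be used before \<open>z\<close> is known to lie in the resolvent set.\<close>

lemma mem_resolvent: "(u, f) \<in> resolvent z S \<longleftrightarrow> (f, z *\<^sub>C f - u) \<in> S"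
proof -
  have "(u, f) \<in> resolvent z S \<longleftrightarrow> (\<exists>v. (f, v) \<in> S \<and> u = z *\<^sub>C f - v)"
    by (auto simp: resolvent_def mem_rel_minus mem_scalar_op)
  also have "\<dots> \<longleftrightarrow> (\<exists>v. (f, v) \<in> S \<and> v = z *\<^sub>C f - u)"
    by (intro ex_cong1 conj_cong refl) (auto simp: algebra_simps)
  finally show ?thesis
    by simp
qed

section \<open>Linearity of sums, products, inverses and adjoints\<close>

lemma linear_relationI:
  assumes "(0, 0) \<in> S" "\<And>x y x' y'. (x, y) \<in> S \<Longrightarrow> (x', y') \<in> S \<Longrightarrow> (x + x', y + y') \<in> S"
    "\<And>c x y. (x, y) \<in> S \<Longrightarrow> (c *\<^sub>C x, c *\<^sub>C y) \<in> S"
  shows "linear_relation S"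
  using assms unfolding linear_relation_def complex_vector.subspace_def
  by (auto simp: zero_prod_def scaleC_prod_def)

lemma linear_relation_zero: "linear_relation S \<Longrightarrow> (0, 0) \<in> S"
  unfolding linear_relation_def complex_vector.subspace_def by (simp add: zero_prod_def)

lemma linear_relation_add:
  "linear_relation S \<Longrightarrow> (x, y) \<in> S \<Longrightarrow> (x', y') \<in> S \<Longrightarrow> (x + x', y + y') \<in> S"
  unfolding linear_relation_def using complex_vector.subspace_add by fastforce

lemma linear_relation_scaleC:
  "linear_relation S \<Longrightarrow> (x, y) \<in> S \<Longrightarrow> (c *\<^sub>C x, c *\<^sub>C y) \<in> S"
  unfolding linear_relation_def using complex_vector.subspace_scale[of S "(x, y)" c]
  by (simp add: scaleC_prod_def)

lemma linear_relation_diff: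
  "linear_relation S \<Longrightarrow> (x, y) \<in> S \<Longrightarrow> (x', y') \<in> S \<Longrightarrow> (x - x', y - y') \<in> S"
  unfolding linear_relation_def using complex_vector.subspace_diff by fastforce

lemmas linear_relation_closed = linear_relation_zero linear_relation_add linear_relation_scaleC

lemma linear_operatorD:
  assumes "linear_operator S"
  shows "linear_relation S" "(x, y) \<in> S \<Longrightarrow> (x, y') \<in> S \<Longrightarrow> y = y'"
  using assms by (auto simp: linear_operator_def single_valued_def)

lemma linear_relation_rel_plus:
  assumes "linear_relation S" "linear_relation T"
  shows "linear_relation (S \<oplus>\<^sub>r T)"
proof (rule linear_relationI)
  show "(0, 0) \<in> S \<oplus>\<^sub>r T"
    unfolding mem_rel_plus using assms by (intro exI[of _ 0]) (simp add: linear_relation_zero)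
next
  fix x y x' y' assume "(x, y) \<in> S \<oplus>\<^sub>r T" "(x', y') \<in> S \<oplus>\<^sub>r T"
  then obtain a b a' b' where "y = a + b" "(x, a) \<in> S" "(x, b) \<in> T"
    "y' = a' + b'" "(x', a') \<in> S" "(x', b') \<in> T"
    by (auto simp: mem_rel_plus)
  then show "(x + x', y + y') \<in> S \<oplus>\<^sub>r T"
    unfolding mem_rel_plus using assms
    by (intro exI[of _ "a + a'"] exI[of _ "b + b'"]) (auto intro: linear_relation_add)
next
  fix c x y assume "(x, y) \<in> S \<oplus>\<^sub>r T"
  then show "(c *\<^sub>C x, c *\<^sub>C y) \<in> S \<oplus>\<^sub>r T"
    using assms by (force simp: mem_rel_plus scaleC_add_right intro: linear_relation_scaleC)
qed

lemma linear_relation_rel_minus: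
  assumes "linear_relation S" "linear_relation T"
  shows "linear_relation (S \<ominus>\<^sub>r T)"
proof (rule linear_relationI)
  show "(0, 0) \<in> S \<ominus>\<^sub>r T"
    unfolding mem_rel_minus using assms by (intro exI[of _ 0]) (simp add: linear_relation_zero)
next
  fix x y x' y' assume "(x, y) \<in> S \<ominus>\<^sub>r T" "(x', y') \<in> S \<ominus>\<^sub>r T"
  then obtain a b a' b' where "y = a - b" "(x, a) \<in> S" "(x, b) \<in> T"
    "y' = a' - b'" "(x', a') \<in> S" "(x', b') \<in> T"
    by (auto simp: mem_rel_minus)
  then show "(x + x', y + y') \<in> S \<ominus>\<^sub>r T"
    unfolding mem_rel_minus using assms
    by (intro exI[of _ "a + a'"] exI[of _ "b + b'"]) (auto intro: linear_relation_add)
next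
  fix c x y assume "(x, y) \<in> S \<ominus>\<^sub>r T"
  then show "(c *\<^sub>C x, c *\<^sub>C y) \<in> S \<ominus>\<^sub>r T"
    using assms
    by (force simp: mem_rel_minus complex_vector.scale_right_diff_distrib
        intro: linear_relation_scaleC)
qed

lemma linear_relation_relcomp:
  assumes "linear_relation S" "linear_relation T"
  shows "linear_relation (S \<odot>\<^sub>r T)"
  using assms by (intro linear_relationI) (blast intro: linear_relation_closed)+

lemma linear_relation_converse: "linear_relation S \<Longrightarrow> linear_relation (S\<inverse>)"
  by (rule linear_relationI) (auto intro: linear_relation_closed)

lemma linear_relation_scalar_op: "linear_relation (scalar_op z)"
  by (rule linear_relationI) (auto simp: mem_scalar_op scaleC_add_right scaleC_scaleC mult.commute)

lemma linear_relation_adj: "linear_relation (adj S)"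
  by (rule linear_relationI) (auto simp: mem_adj cinner_linear)

lemma linear_relation_resolvent: "linear_relation S \<Longrightarrow> linear_relation (resolvent z S)"
  unfolding resolvent_def
  by (intro linear_relation_converse linear_relation_rel_minus linear_relation_scalar_op)

section \<open>Adjoints and resolvents of everywhere defined operators\<close>

lemma single_valued_adj:
  assumes "Domain S = UNIV"
  shows "single_valued (adj S)"
proof (rule single_valuedI)
  fix y x x' assume *: "(y, x) \<in> adj S" "(y, x') \<in> adj S"
  show "x = x'"
  proof (rule cinner_cancel)
    fix u
    obtain v where "(u, v) \<in> S"
      using assms by blast
    then show "cinner x u = cinner x' u"
      using * by (metis mem_adj)
  qed
qed

lemma bounded_operatorE:
  assumes "bounded_operator S"
  obtains K where "\<And>x y. (x, y) \<in> S \<Longrightarrow> norm y \<le> K * norm x"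
  using assms unfolding bounded_operator_def by (metis case_prodD)

text \<open>For fixed \<open>y\<close> the functional sending \<open>u\<close> to
  \<open>cinner y (s u)\<close> is bounded and linear, and its Riesz vector is the value of the
  adjoint at \<open>y\<close>.\<close>

lemma Domain_adj_bounded_operator:
  fixes S :: "('a::chilbert_space \<times> 'b::complex_inner) set"
  assumes "bounded_operator S"
  shows "Domain (adj S) = UNIV"
proof -
  obtain K where K: "\<And>x y. (x, y) \<in> S \<Longrightarrow> norm y \<le> K * norm x"
    using assms by (rule bounded_operatorE) blast
  have S: "linear_operator S" "Domain S = UNIV"
    using assms by (simp_all add: bounded_operator_def)
  have "\<forall>x. \<exists>y. (x, y) \<in> S"
    using S(2) by blast
  then obtain s where s: "(x, s x) \<in> S" for x
    by metis
  have s_eq: "(x, y) \<in> S \<longleftrightarrow> y = s x" for x y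
    using s linear_operatorD(2)[OF S(1)] by blast
  note lin = linear_operatorD(1)[OF S(1)]
  have "\<exists>x. (y, x) \<in> adj S" for y
  proof -
    have "\<exists>x. \<forall>u. cinner y (s u) = cinner x u"
    proof (rule riesz_representation)
      show "cinner y (s (u + v)) = cinner y (s u) + cinner y (s v)" for u v
        using linear_relation_add[OF lin s s, of u v] by (metis s_eq cinner_add_right)
      show "cinner y (s (c *\<^sub>C u)) = c * cinner y (s u)" for c u
        using linear_relation_scaleC[OF lin s, of c u] by (metis s_eq cinner_scaleC_right)
      show "cmod (cinner y (s u)) \<le> (norm y * K) * norm u" for u
        using cmod_cinner_le[of y "s u"] mult_left_mono[OF K[OF s[of u]] norm_ge_zero[of y]]
        by (simp add: mult.assoc)
    qed
    then show ?thesis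
      by (auto simp: mem_adj s_eq)
  qed
  then show ?thesis
    by blast
qed

lemma Domain_resolvent: "z \<in> resolvent_set S \<Longrightarrow> Domain (resolvent z S) = UNIV"
  by (simp add: resolvent_set_def bounded_operator_def)

lemma single_valued_resolvent: "z \<in> resolvent_set S \<Longrightarrow> single_valued (resolvent z S)"
  by (simp add: resolvent_set_def bounded_operator_def linear_operator_def)

lemma resolvent_setI:
  assumes "bounded_operator (resolvent z S)"
  shows "z \<in> resolvent_set S"
proof -
  have "(0, 0) \<in> resolvent z S" "single_valued (resolvent z S)" "Domain (resolvent z S) = UNIV"
    using assms by (auto simp: bounded_operator_def linear_operator_def linear_relation_zero)
  moreover have "x = 0" if "(x, 0) \<in> scalar_op z \<ominus>\<^sub>r S" for x
    using that calculation unfolding resolvent_def by (auto dest: single_valuedD)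
  ultimately show ?thesis
    using assms unfolding resolvent_set_def one_to_one_def by (auto simp: resolvent_def)
qed

text \<open>Self-adjointness identifies the resolvent at \<open>cnj z\<close> with the adjoint of
  the resolvent at \<open>z\<close>, and the adjoint of a bounded operator is bounded.\<close>

lemma cnj_resolvent_set:
  fixes S :: "('a::chilbert_space \<times> 'a) set"
  assumes S: "selfadjoint_relation S" and z: "z \<in> resolvent_set S"
  shows "cnj z \<in> resolvent_set S"
proof (rule resolvent_setI)
  have bounded: "bounded_operator (resolvent z S)"
    using z by (simp add: resolvent_set_def)
  have S_eq: "adj S = S"
    using S by (simp add: selfadjoint_relation_def)
  have eq: "resolvent (cnj z) S = adj (resolvent z S)"
  proof (intro equalityI subrelI)
    fix y x assume "(y, x) \<in> resolvent (cnj z) S"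
    then have "(x, cnj z *\<^sub>C x - y) \<in> adj S"
      by (simp add: mem_resolvent S_eq)
    then have x: "cinner x w = cinner (cnj z *\<^sub>C x - y) v" if "(v, w) \<in> S" for v w
      using that unfolding mem_adj by blast
    show "(y, x) \<in> adj (resolvent z S)"
      unfolding mem_adj mem_resolvent by (auto dest!: x simp: cinner_linear)
  next
    fix y x assume *: "(y, x) \<in> adj (resolvent z S)"
    have "cinner x w = cinner (cnj z *\<^sub>C x - y) v" if "(v, w) \<in> S" for v w
    proof -
      have "(z *\<^sub>C v - w, v) \<in> resolvent z S"
        using that by (simp add: mem_resolvent)
      then have "cinner y v = cinner x (z *\<^sub>C v - w)"
        using * unfolding mem_adj by blast
      then show ?thesis
        by (simp add: cinner_linear)
    qed
    then have "(x, cnj z *\<^sub>C x - y) \<in> adj S"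
      unfolding mem_adj by blast
    then show "(y, x) \<in> resolvent (cnj z) S"
      by (simp add: mem_resolvent S_eq)
  qed
  obtain K where K: "\<And>x y. (x, y) \<in> resolvent z S \<Longrightarrow> norm y \<le> K * norm x"
    using bounded by (rule bounded_operatorE) blast
  have "norm x \<le> K * norm y" if "(y, x) \<in> adj (resolvent z S)" for x y
  proof -
    obtain v where v: "(x, v) \<in> resolvent z S"
      using Domain_resolvent[OF z] by blast
    \<comment> \<open>The value \<open>x\<close> of the adjoint at \<open>y\<close> is tested on the
      argument \<open>x\<close> itself.\<close>
    then have "norm x * norm x = Re (cinner y v)"
      using that by (simp add: mem_adj power2_norm_eq_cinner flip: power2_eq_square)
    also have "\<dots> \<le> norm y * (K * norm x)"
      using Re_cinner_le[of y v] mult_left_mono[OF K[OF v] norm_ge_zero[of y]] by linarith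
    finally have le: "norm x * norm x \<le> (K * norm y) * norm x"
      by (simp add: mult_ac)
    \<comment> \<open>\<open>K\<close> has no known sign, and for \<open>x = 0\<close> the factor
      \<open>norm x\<close> cannot be cancelled; the bound at \<open>y\<close> supplies the
      sign.\<close>
    have "0 \<le> K * norm y" if "x = 0"
    proof -
      obtain w where "(y, w) \<in> resolvent z S"
        using Domain_resolvent[OF z] by blast
      then show ?thesis
        using K[of y w] norm_ge_zero[of w] by linarith
    qed
    then show ?thesis
      using le by (cases "x = 0") (simp_all add: mult_le_cancel_right)
  qed
  then show "bounded_operator (resolvent (cnj z) S)"
    unfolding bounded_operator_def linear_operator_def eq
    using linear_relation_adj single_valued_adj[OF Domain_resolvent[OF z]]
      Domain_adj_bounded_operator[OF bounded] by blast
qed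

section \<open>Symmetry and self-adjointness of relations\<close>

lemma symmetric_relationI:
  "(\<And>x y u v. (x, y) \<in> S \<Longrightarrow> (u, v) \<in> S \<Longrightarrow> cinner x v = cinner y u) \<Longrightarrow> symmetric_relation S"
  unfolding symmetric_relation_def by (auto simp: mem_adj)

lemma adj_flip: "(y, x) \<in> adj S \<Longrightarrow> (u, v) \<in> S \<Longrightarrow> cinner v y = cinner u x"
  by (metis cinner_commute mem_adj)

lemma symmetric_relationD:
  "symmetric_relation S \<Longrightarrow> (x, y) \<in> S \<Longrightarrow> (u, v) \<in> S \<Longrightarrow> cinner x v = cinner y u"
  unfolding symmetric_relation_def by (meson mem_adj subsetD)

text \<open>Since \<open>z\<close> is real, the resolvent inherits symmetry from \<open>S\<close>.
  Being defined everywhere, it is then single-valued, and Hellinger-Toeplitz bounds it. Surjectivity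
  of \<open>z - S\<close> leaves no room for a proper extension by the adjoint.\<close>

lemma symmetric_relation_surjective:
  fixes S :: "('a::chilbert_space \<times> 'a) set"
  assumes lin: "linear_relation S" and sym: "symmetric_relation S"
    and z: "z \<in> \<real>" and surj: "Domain (resolvent z S) = UNIV"
  shows "selfadjoint_relation S" "z \<in> resolvent_set S"
proof -
  have cnj: "cnj z = z"
    using z Reals_cnj_iff by blast
  have res_sym: "cinner f v = cinner u g" if "(u, f) \<in> resolvent z S" "(v, g) \<in> resolvent z S" for u f v g
    using that symmetric_relationD[OF sym, of f "z *\<^sub>C f - u" g "z *\<^sub>C g - v"]
    by (simp add: mem_resolvent cinner_linear cnj)
  have "\<forall>u. \<exists>f. (u, f) \<in> resolvent z S"
    using surj by blast
  then obtain r where r: "(u, r u) \<in> resolvent z S" for u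
    by metis
  have res: "(u, f) \<in> resolvent z S \<longleftrightarrow> f = r u" for u f
  proof
    assume f: "(u, f) \<in> resolvent z S"
    show "f = r u"
      \<comment> \<open>By symmetry, \<open>f\<close> and \<open>r u\<close> both pair with any
        \<open>v\<close> to give \<open>cinner u (r v)\<close>.\<close>
      by (rule cinner_cancel) (metis f r res_sym)
  qed (use r in auto)
  obtain c where "\<And>u. norm (r u) \<le> c * norm u"
    using hellinger_toeplitz[of r] res_sym[OF r r] by blast
  then have "\<forall>(u, f)\<in>resolvent z S. norm f \<le> c * norm u"
    by (auto simp: res)
  moreover have "single_valued (resolvent z S)"
    by (simp add: single_valued_def res)
  ultimately have "bounded_operator (resolvent z S)"
    unfolding bounded_operator_def linear_operator_def
    using linear_relation_resolvent[OF lin] surj by blast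
  then show "z \<in> resolvent_set S"
    by (rule resolvent_setI)
  have "(y, x) \<in> S" if "(y, x) \<in> adj S" for x y
  proof -
    \<comment> \<open>\<open>g\<close> solves in \<open>S\<close> the equation that \<open>y\<close>
      solves in \<open>adj S\<close>; pairing with an arbitrary \<open>u\<close> then shows
      \<open>y = g\<close>.\<close>
    obtain g where g: "(z *\<^sub>C y - x, g) \<in> resolvent z S"
      using r by blast
    have "cinner y u = cinner g u" for u
    proof -
      have "cinner y (z *\<^sub>C r u - u) = cinner x (r u)"
        using that r[of u] by (simp add: mem_adj mem_resolvent)
      then have "cinner y u = cinner (z *\<^sub>C y - x) (r u)"
        by (simp add: cinner_linear cnj algebra_simps)
      also have "\<dots> = cinner g u"
        using res_sym[OF g r] by simp
      finally show ?thesis .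
    qed
    then have "y = g"
      by (rule cinner_cancel)
    then show ?thesis
      using g by (auto simp: mem_resolvent)
  qed
  then show "selfadjoint_relation S"
    using sym unfolding selfadjoint_relation_def symmetric_relation_def by auto
qed


section \<open>Green's identity\<close>

context ibc_setting
begin

text \<open>\<open>G_op\<close> at \<open>z\<close> is built from the resolvent at
  \<open>cnj z\<close>, so the assumptions of the setting are always invoked at the conjugate
  point.\<close>

lemma cnj_resolvent_set_L: "z \<in> resolvent_set (L_op Lm B) \<Longrightarrow> cnj z \<in> resolvent_set (L_op Lm B)"
  by (rule cnj_resolvent_set[OF L_selfadjoint])

lemma mem_L_op: "(f, h) \<in> L_op Lm B \<longleftrightarrow> (f, h) \<in> Lm \<and> (f, 0) \<in> B"
  by (simp add: L_op_def mem_rel_restrict mem_ker)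

lemma mem_A_op: "(f, a) \<in> A_op B Am \<longleftrightarrow> (f, a) \<in> Am \<and> (f, 0) \<in> B"
  by (simp add: A_op_def mem_rel_restrict mem_ker)

lemma L_op_domain_Am: "(f, h) \<in> L_op Lm B \<Longrightarrow> \<exists>a. (f, a) \<in> Am"
  using A_relatively_bounded mem_A_op unfolding relatively_bounded_def by blast

lemma G_op_eigenvector:
  assumes z: "z \<in> resolvent_set (L_op Lm B)" and h: "(\<phi>, h) \<in> G_op Lm B Am z"
  shows "(h, z *\<^sub>C h) \<in> Lm"
proof -
  have "(h, 0) \<in> scalar_op z \<ominus>\<^sub>r Lm"
    using Range_in_kernel[OF cnj_resolvent_set_L[OF z]] h by (auto simp: G_op_def ker_def)
  then show ?thesis
    by (auto simp: mem_rel_minus mem_scalar_op)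
qed

text \<open>The eigenvector \<open>h\<close> lies in the domain of \<open>Lm\<close>, hence of
  \<open>B\<close>, and \<open>B G = Id\<close> forces its trace to be
  \<open>\<phi>\<close>.\<close>

lemma G_op_trace:
  assumes z: "z \<in> resolvent_set (L_op Lm B)" and h: "(\<phi>, h) \<in> G_op Lm B Am z"
  shows "(h, \<phi>) \<in> B"
proof -
  obtain \<phi>' where "(h, \<phi>') \<in> B"
    using G_op_eigenvector[OF z h] B_domain by blast
  moreover from this h have "(\<phi>, \<phi>') \<in> Id"
    by (subst B_right_inverse[OF cnj_resolvent_set_L[OF z], symmetric]) (auto simp: G_op_def)
  ultimately show ?thesis
    by simp
qed

lemma G_op_total:
  assumes z: "z \<in> resolvent_set (L_op Lm B)"
  shows "\<exists>h. (\<phi>, h) \<in> G_op Lm B Am z"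
proof -
  have "(\<phi>, \<phi>) \<in> Id"
    by simp
  then show ?thesis
    unfolding B_right_inverse[OF cnj_resolvent_set_L[OF z], symmetric] G_op_def by blast
qed

lemma linear_relation_G_op: "linear_relation (G_op Lm B Am z)"
  unfolding G_op_def by (rule linear_relation_adj)

lemma single_valued_G_op:
  assumes z: "z \<in> resolvent_set (L_op Lm B)"
  shows "single_valued (G_op Lm B Am z)"
  unfolding G_op_def
proof (rule single_valued_adj)
  have "\<exists>a. (u, a) \<in> A_op B Am \<odot>\<^sub>r resolvent (cnj z) (L_op Lm B)" for u
  proof -
    obtain f where f: "(u, f) \<in> resolvent (cnj z) (L_op Lm B)"
      using Domain_resolvent[OF cnj_resolvent_set_L[OF z]] by blast
    then have "(f, cnj z *\<^sub>C f - u) \<in> L_op Lm B"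
      by (simp add: mem_resolvent)
    moreover from this obtain a where "(f, a) \<in> Am"
      using L_op_domain_Am by blast
    ultimately have "(f, a) \<in> A_op B Am"
      by (simp add: mem_L_op mem_A_op)
    with f show ?thesis
      by blast
  qed
  then show "Domain (A_op B Am \<odot>\<^sub>r resolvent (cnj z) (L_op Lm B)) = UNIV"
    by blast
qed

text \<open>This is the defining identity of the adjoint \<open>G\<close>, tested on the vector
  \<open>(cnj z - L) f\<close>, whose image under the resolvent is \<open>f\<close>.\<close>

lemma G_op_pairing:
  assumes h: "(\<phi>, h) \<in> G_op Lm B Am z" and f: "(f, f') \<in> L_op Lm B" and a: "(f, a) \<in> Am"
  shows "cinner \<phi> a = cinner h (cnj z *\<^sub>C f - f')"
proof -
  have "(cnj z *\<^sub>C f - f', f) \<in> resolvent (cnj z) (L_op Lm B)"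
    using f by (simp add: mem_resolvent)
  moreover have "(f, a) \<in> A_op B Am"
    using f a by (simp add: mem_L_op mem_A_op)
  ultimately have "(cnj z *\<^sub>C f - f', a) \<in> A_op B Am \<odot>\<^sub>r resolvent (cnj z) (L_op Lm B)"
    by blast
  then show ?thesis
    using h unfolding G_op_def mem_adj by blast
qed

text \<open>Subtracting the eigenvector \<open>h\<close> with the same trace as \<open>f\<close>
  leaves an element of \<open>ker B\<close>. The domain of \<open>L\<close> lies in that of
  \<open>Am\<close>, so \<open>h\<close> inherits membership in the latter from
  \<open>f\<close>.\<close>

lemma Lm_decomposition:
  assumes z: "z \<in> resolvent_set (L_op Lm B)"
    and f: "(f, f') \<in> Lm" "(f, a) \<in> Am" "(f, \<phi>) \<in> B"
  obtains f0 f0' a0 h t where "f = f0 + h" "f' = f0' + z *\<^sub>C h" "a = a0 + t"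
    "(f0, f0') \<in> L_op Lm B" "(f0, a0) \<in> Am" "(\<phi>, h) \<in> G_op Lm B Am z" "(h, t) \<in> Am"
proof -
  obtain h where h: "(\<phi>, h) \<in> G_op Lm B Am z"
    using G_op_total[OF z] by blast
  have "(f - h, f' - z *\<^sub>C h) \<in> Lm"
    using f G_op_eigenvector[OF z h] linear_operatorD(1)[OF Lm_operator]
    by (blast intro: linear_relation_diff)
  moreover have "(f - h, \<phi> - \<phi>) \<in> B"
    using f G_op_trace[OF z h] linear_operatorD(1)[OF B_operator]
    by (blast intro: linear_relation_diff)
  ultimately have L: "(f - h, f' - z *\<^sub>C h) \<in> L_op Lm B"
    by (simp add: mem_L_op)
  then obtain a0 where a0: "(f - h, a0) \<in> Am"
    using L_op_domain_Am by blast
  have "(f - (f - h), a - a0) \<in> Am"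
    using f a0 linear_operatorD(1)[OF Am_operator] by (blast intro: linear_relation_diff)
  then show thesis
    using that[of "f - h" h "f' - z *\<^sub>C h" a0 "a - a0"] h L a0 by simp
qed

lemma green_Lm:
  assumes z: "z \<in> resolvent_set (L_op Lm B)"
    and f: "(f, f') \<in> Lm" "(f, a) \<in> Am" "(f, \<phi>) \<in> B"
    and g: "(g, g') \<in> Lm" "(g, b) \<in> Am" "(g, \<psi>) \<in> B"
  shows "cinner f' g - cinner f g' = cinner \<phi> b - cinner a \<psi>"
proof -
  obtain f0 f0' a0 h t where f_eq: "f = f0 + h" "f' = f0' + z *\<^sub>C h" "a = a0 + t"
    and F: "(f0, f0') \<in> L_op Lm B" "(f0, a0) \<in> Am" "(\<phi>, h) \<in> G_op Lm B Am z" "(h, t) \<in> Am"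
    using Lm_decomposition[OF z f] .
  \<comment> \<open>Using the conjugate parameter for \<open>g\<close> makes the terms in
    \<open>cinner h k\<close> cancel.\<close>
  obtain g0 g0' b0 k s where g_eq: "g = g0 + k" "g' = g0' + cnj z *\<^sub>C k" "b = b0 + s"
    and G: "(g0, g0') \<in> L_op Lm B" "(g0, b0) \<in> Am" "(\<psi>, k) \<in> G_op Lm B Am (cnj z)" "(k, s) \<in> Am"
    using Lm_decomposition[OF cnj_resolvent_set_L[OF z] g] .
  have "symmetric_relation (L_op Lm B)"
    using L_selfadjoint by (simp add: selfadjoint_relation_def symmetric_relation_def)
  then have 1: "cinner f0 g0' = cinner f0' g0"
    using F(1) G(1) by (rule symmetric_relationD)
  have 2: "cinner \<phi> b0 = cinner h (cnj z *\<^sub>C g0 - g0')"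
    by (rule G_op_pairing[OF F(3) G(1,2)])
  have "cinner \<psi> a0 = cinner k (z *\<^sub>C f0 - f0')"
    using G_op_pairing[OF G(3) F(1,2)] by simp
  then have 3: "cinner a0 \<psi> = cinner (z *\<^sub>C f0 - f0') k"
    by (metis cinner_commute)
  \<comment> \<open>The remaining boundary terms come from the two \<open>G\<close>-parts and agree
    by the symmetry of \<open>T\<close>.\<close>
  have "(\<phi>, t) \<in> T_op Lm B Am z" "(\<psi>, s) \<in> adj (T_op Lm B Am z)"
    using F G T_adjoint[OF z] by (auto simp: T_op_def)
  then have 4: "cinner t \<psi> = cinner \<phi> s"
    by (metis adj_flip)
  show ?thesis
    unfolding f_eq g_eq by (simp add: cinner_linear 1 2 3 4 algebra_simps)
qed

section \<open>Green's identity for \<open>H_max\<close> and symmetry of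
  \<open>H_rel\<close>\<close>

lemma J_relation: "linear_relation J" "\<exists>v. (u, v) \<in> J"
  using J_bounded by (auto simp: bounded_operator_def linear_operator_def)

lemma single_valued_adj_J: "(f, j) \<in> adj J \<Longrightarrow> (f, j') \<in> adj J \<Longrightarrow> j = j'"
  using J_bounded single_valued_adj[of J] by (auto simp: bounded_operator_def dest: single_valuedD)

lemma mem_H_max: "(f, h) \<in> H_max Lm B Am J \<longleftrightarrow>
    (\<exists>f' \<phi> a j p q. (f, f') \<in> Lm \<and> (f, \<phi>) \<in> B \<and> (f, a) \<in> Am \<and> (f, j) \<in> adj J \<and>
      (j, p) \<in> J \<and> (a - \<phi>, q) \<in> J \<and> h = f' + p + q)"
  unfolding H_max_def mem_rel_plus relcomp_unfold mem_rel_minus by blast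

text \<open>\<open>B\<close>, \<open>Am\<close> and \<open>adj J\<close> are single-valued, so the
  three memberships share one vector \<open>j\<close>, and the difference of the unshifted traces is
  still \<open>a - \<phi>\<close>.\<close>

lemma H_maxE:
  assumes "(f, h) \<in> H_max Lm B Am J" "(f, \<phi>) \<in> B \<ominus>\<^sub>r adj J" "(f, a) \<in> Am \<ominus>\<^sub>r adj J"
  obtains f' j p q where "(f, f') \<in> Lm" "(f, \<phi> + j) \<in> B" "(f, a + j) \<in> Am" "(f, j) \<in> adj J"
    "(j, p) \<in> J" "(a - \<phi>, q) \<in> J" "h = f' + p + q"
proof -
  obtain f' \<phi>' a' j p q where H: "(f, f') \<in> Lm" "(f, \<phi>') \<in> B" "(f, a') \<in> Am" "(f, j) \<in> adj J"
      "(j, p) \<in> J" "(a' - \<phi>', q) \<in> J" "h = f' + p + q"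
    using assms(1) by (auto simp: mem_H_max)
  obtain \<phi>'' j'' where "\<phi> = \<phi>'' - j''" "(f, \<phi>'') \<in> B" "(f, j'') \<in> adj J"
    using assms(2) by (auto simp: mem_rel_minus)
  then have \<phi>: "\<phi>' = \<phi> + j"
    using H linear_operatorD(2)[OF B_operator] single_valued_adj_J
    by (metis diff_add_cancel)
  obtain a'' j'' where "a = a'' - j''" "(f, a'') \<in> Am" "(f, j'') \<in> adj J"
    using assms(3) by (auto simp: mem_rel_minus)
  then have "a' = a + j"
    using H linear_operatorD(2)[OF Am_operator] single_valued_adj_J
    by (metis diff_add_cancel)
  with \<phi> H show thesis
    by (intro that[of f' j p q]) auto
qed

text \<open>Substituting \<open>\<phi> + j\<close> and \<open>a + j\<close> into Green's identity
  for \<open>Lm\<close> produces extra terms in \<open>j\<close> and \<open>l\<close>; moving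
  \<open>J\<close> to the other side in the added parts of \<open>H_max\<close> cancels exactly
  these.\<close>

lemma green_H_max:
  assumes z: "z \<in> resolvent_set (L_op Lm B)"
    and f: "(f, h) \<in> H_max Lm B Am J" "(f, \<phi>) \<in> B \<ominus>\<^sub>r adj J" "(f, a) \<in> Am \<ominus>\<^sub>r adj J"
    and g: "(g, k) \<in> H_max Lm B Am J" "(g, \<psi>) \<in> B \<ominus>\<^sub>r adj J" "(g, b) \<in> Am \<ominus>\<^sub>r adj J"
  shows "cinner h g - cinner f k = cinner \<phi> b - cinner a \<psi>"
proof -
  obtain f' j p q where F: "(f, f') \<in> Lm" "(f, \<phi> + j) \<in> B" "(f, a + j) \<in> Am" "(f, j) \<in> adj J"
    "(j, p) \<in> J" "(a - \<phi>, q) \<in> J" and h: "h = f' + p + q"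
    using H_maxE[OF f] .
  obtain g' l r s where G: "(g, g') \<in> Lm" "(g, \<psi> + l) \<in> B" "(g, b + l) \<in> Am" "(g, l) \<in> adj J"
    "(l, r) \<in> J" "(b - \<psi>, s) \<in> J" and k: "k = g' + r + s"
    using H_maxE[OF g] .
  have "cinner f' g - cinner f g' = cinner (\<phi> + j) (b + l) - cinner (a + j) (\<psi> + l)"
    by (rule green_Lm[OF z F(1,3,2) G(1,3,2)])
  moreover have "cinner p g = cinner j l" "cinner q g = cinner (a - \<phi>) l"
    using adj_flip[OF G(4)] F by auto
  moreover have "cinner f r = cinner j l" "cinner f s = cinner j (b - \<psi>)"
    using F(4) G by (auto simp: mem_adj)
  moreover have "cinner h g - cinner f k
      = (cinner f' g - cinner f g') + cinner p g + cinner q g - cinner f r - cinner f s"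
    unfolding h k by (simp add: cinner_linear)
  ultimately show ?thesis
    by (simp add: cinner_linear)
qed

lemma linear_relations:
  "linear_relation (H_max Lm B Am J)" "linear_relation (B \<ominus>\<^sub>r adj J)"
  "linear_relation (Am \<ominus>\<^sub>r adj J)"
  unfolding H_max_def
  by (intro linear_relation_rel_plus linear_relation_rel_minus linear_relation_relcomp
      linear_relation_adj J_relation(1) linear_operatorD(1)[OF Lm_operator]
      linear_operatorD(1)[OF B_operator] linear_operatorD(1)[OF Am_operator])+

lemma mem_H_rel: "(f, h) \<in> H_rel Lm B Am J R \<longleftrightarrow> (f, h) \<in> H_max Lm B Am J \<and>
    (\<exists>\<phi> \<eta>. (f, \<phi>) \<in> B \<ominus>\<^sub>r adj J \<and> (f, \<eta>) \<in> Am \<ominus>\<^sub>r adj J \<and> (\<phi>, \<eta>) \<in> R)"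
  unfolding H_rel_def mem_rel_restrict by simp

lemma linear_relation_H_rel:
  assumes R: "linear_relation R"
  shows "linear_relation (H_rel Lm B Am J R)"
proof (rule linear_relationI)
  show "(0, 0) \<in> H_rel Lm B Am J R"
    unfolding mem_H_rel using linear_relations R by (blast intro: linear_relation_zero)
next
  fix x y x' y' assume "(x, y) \<in> H_rel Lm B Am J R" "(x', y') \<in> H_rel Lm B Am J R"
  then show "(x + x', y + y') \<in> H_rel Lm B Am J R"
    unfolding mem_H_rel using linear_relations R by (blast intro: linear_relation_add)
next
  fix c x y assume "(x, y) \<in> H_rel Lm B Am J R"
  then show "(c *\<^sub>C x, c *\<^sub>C y) \<in> H_rel Lm B Am J R"
    unfolding mem_H_rel using linear_relations R by (blast intro: linear_relation_scaleC)
qed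

text \<open>The boundary form in Green's identity vanishes on pairs taken from a symmetric
  relation.\<close>

lemma symmetric_relation_H_rel:
  assumes z: "z \<in> resolvent_set (L_op Lm B)" and R: "symmetric_relation R"
  shows "symmetric_relation (H_rel Lm B Am J R)"
proof (rule symmetric_relationI)
  fix f h g k assume "(f, h) \<in> H_rel Lm B Am J R" "(g, k) \<in> H_rel Lm B Am J R"
  then obtain \<phi> \<eta> \<psi> \<xi> where
    f: "(f, h) \<in> H_max Lm B Am J" "(f, \<phi>) \<in> B \<ominus>\<^sub>r adj J" "(f, \<eta>) \<in> Am \<ominus>\<^sub>r adj J" "(\<phi>, \<eta>) \<in> R" and
    g: "(g, k) \<in> H_max Lm B Am J" "(g, \<psi>) \<in> B \<ominus>\<^sub>r adj J" "(g, \<xi>) \<in> Am \<ominus>\<^sub>r adj J" "(\<psi>, \<xi>) \<in> R"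
    unfolding mem_H_rel by blast
  have "cinner h g - cinner f k = cinner \<phi> \<xi> - cinner \<eta> \<psi>"
    by (rule green_H_max[OF z f(1-3) g(1-3)])
  then show "cinner f k = cinner h g"
    using symmetric_relationD[OF R f(4) g(4)] by simp
qed

text \<open>On this domain \<open>B f\<close> and \<open>J* f\<close> are the same vector
  \<open>\<phi>\<close>, so the terms \<open>J \<phi>\<close> in \<open>H_max\<close> cancel and
  only \<open>J a\<close> remains.\<close>

lemma H_IBC_subset:
  assumes "(f, h) \<in> H_IBC Lm B Am J"
  shows "(f, h) \<in> H_max Lm B Am J" "(f, 0) \<in> B \<ominus>\<^sub>r adj J" "\<exists>a. (f, a) \<in> Am \<ominus>\<^sub>r adj J"
proof -
  obtain f' a q \<phi> where f: "(f, f') \<in> Lm" "(f, a) \<in> Am" "(a, q) \<in> J" "h = f' + q"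
    "(f, \<phi>) \<in> B" "(f, \<phi>) \<in> adj J"
    using assms unfolding H_IBC_def mem_rel_restrict mem_rel_plus by blast
  obtain p where p: "(\<phi>, p) \<in> J"
    using J_relation by blast
  then have "(a - \<phi>, q - p) \<in> J"
    using f J_relation by (blast intro: linear_relation_diff)
  moreover have "h = f' + p + (q - p)"
    using f by simp
  ultimately show "(f, h) \<in> H_max Lm B Am J"
    unfolding mem_H_max using f p by blast
  show "(f, 0) \<in> B \<ominus>\<^sub>r adj J" "\<exists>a. (f, a) \<in> Am \<ominus>\<^sub>r adj J"
    using f by (force simp: mem_rel_minus)+
qed


section \<open>The boundary maps of the interior-boundary Hamiltonian\<close>

lemma H_IBC_trace_total:
  assumes z: "z \<in> resolvent_set (H_IBC Lm B Am J)"
  obtains f v where "(u, f) \<in> resolvent z (H_IBC Lm B Am J)" "(f, v) \<in> Am \<ominus>\<^sub>r adj J"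
proof -
  obtain f where "(u, f) \<in> resolvent z (H_IBC Lm B Am J)"
    using Domain_resolvent[OF z] by blast
  then show thesis
    using that H_IBC_subset(3) unfolding mem_resolvent by blast
qed

lemma single_valued_F_op:
  assumes "cnj z \<in> resolvent_set (H_IBC Lm B Am J)"
  shows "single_valued (F_op Lm B Am J z)"
proof -
  have "Domain ((Am \<ominus>\<^sub>r adj J) \<odot>\<^sub>r resolvent (cnj z) (H_IBC Lm B Am J)) = UNIV"
    using H_IBC_trace_total[OF assms] by blast
  then show ?thesis
    unfolding F_op_def rel_restrict_def
    by (intro single_valued_subset[OF _ single_valued_adj]) auto
qed

text \<open>A relation lies in its double adjoint, and restricting \<open>F\<close> to
  \<open>D(T)\<close> only enlarges the adjoint. This brings traces of the \<open>H_IBC\<close>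
  resolvent into the range of \<open>adj F\<close>.\<close>

lemma F_op_adjoint:
  "(Am \<ominus>\<^sub>r adj J) \<odot>\<^sub>r resolvent (cnj z) (H_IBC Lm B Am J) \<subseteq> adj (F_op Lm B Am J z)"
proof (rule subrelI)
  fix u v assume uv: "(u, v) \<in> (Am \<ominus>\<^sub>r adj J) \<odot>\<^sub>r resolvent (cnj z) (H_IBC Lm B Am J)"
  have "cinner u f = cinner v \<phi>" if "(\<phi>, f) \<in> F_op Lm B Am J z" for \<phi> f
    using that adj_flip[OF _ uv] unfolding F_op_def mem_rel_restrict by metis
  then show "(u, v) \<in> adj (F_op Lm B Am J z)"
    unfolding mem_adj by blast
qed

text \<open>\<open>F\<close> is defined by duality, so a solution \<open>f\<close> of the boundary
  value problem is constructed directly and Green's identity then shows that it is the value of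
  \<open>F\<close> at \<open>\<phi>\<close>.\<close>

lemma F_op_solves:
  assumes cond: "ibc_condition Lm B Am J z" and real: "z \<in> \<real>"
    and \<phi>: "\<phi> \<in> Domain (T_op Lm B Am z)"
  shows "\<exists>f. (\<phi>, f) \<in> F_op Lm B Am J z \<and> (f, z *\<^sub>C f) \<in> H_max Lm B Am J \<and> (f, \<phi>) \<in> B \<ominus>\<^sub>r adj J"
proof -
  have cnj: "cnj z = z"
    using real Reals_cnj_iff by blast
  have z: "z \<in> resolvent_set (L_op Lm B)" "z \<in> resolvent_set (H_IBC Lm B Am J)"
    and one: "1 \<in> resolvent_set (G_op Lm B Am z \<odot>\<^sub>r adj J)"
    and invariant: "(Id \<ominus>\<^sub>r adj J \<odot>\<^sub>r G_op Lm B Am z)\<inverse> `` Domain (T_op Lm B Am z)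
      \<subseteq> Domain (T_op Lm B Am z)"
    using cond by (auto simp: ibc_condition_def)
  \<comment> \<open>\<open>w = G \<psi>\<close> with \<open>\<psi> = (1 - J* G)\<inverse> \<phi>\<close> has the right boundary value, since \<open>(B - J*) w = \<psi> - J* G \<psi> = \<phi>\<close>;
    adding an element of the domain of \<open>H_IBC\<close> turns it into an eigenvector without changing it.\<close>
  obtain w0 where w0: "(\<phi>, w0) \<in> G_op Lm B Am z"
    using G_op_total[OF z(1)] by blast
  \<comment> \<open>The invertibility assumption concerns \<open>1 - G J*\<close> on the large
    space, so \<open>w - G J* w = w0\<close> is solved there; then
    \<open>w = G (\<phi> + j)\<close>.\<close>
  obtain w where "(w0, w) \<in> resolvent 1 (G_op Lm B Am z \<odot>\<^sub>r adj J)"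
    using Domain_resolvent[OF one] by blast
  then obtain j where j: "(w, j) \<in> adj J" "(j, w - w0) \<in> G_op Lm B Am z"
    by (auto simp: mem_resolvent scaleC_one)
  define \<psi> where "\<psi> = \<phi> + j"
  have "(\<phi> + j, w0 + (w - w0)) \<in> G_op Lm B Am z"
    by (rule linear_relation_add[OF linear_relation_G_op w0 j(2)])
  then have \<psi>: "(\<psi>, w) \<in> G_op Lm B Am z"
    by (simp add: \<psi>_def)
  have "(\<psi>, \<psi> - j) \<in> Id \<ominus>\<^sub>r adj J \<odot>\<^sub>r G_op Lm B Am z"
    unfolding mem_rel_minus using \<psi> j by blast
  \<comment> \<open>As \<open>(1 - J* G) \<psi> = \<phi>\<close>, invariance puts
    \<open>\<psi>\<close> in \<open>D(T)\<close>, which is what places \<open>w\<close> in the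
    domain of \<open>Am\<close>.\<close>
  then have "\<psi> \<in> (Id \<ominus>\<^sub>r adj J \<odot>\<^sub>r G_op Lm B Am z)\<inverse> `` Domain (T_op Lm B Am z)"
    using \<phi> by (auto simp: \<psi>_def)
  then obtain t where "(\<psi>, t) \<in> T_op Lm B Am z"
    using invariant by blast
  then have t: "(w, t) \<in> Am"
    using \<psi> single_valuedD[OF single_valued_G_op[OF z(1)]] unfolding T_op_def by blast
  note w = G_op_eigenvector[OF z(1) \<psi>] G_op_trace[OF z(1) \<psi>]
  obtain p q where "(j, p) \<in> J" "(t - \<psi>, q) \<in> J"
    using J_relation by blast
  then obtain k where k: "(w, k) \<in> H_max Lm B Am J"
    unfolding mem_H_max using w t j by blast
  have w_B: "(w, \<phi>) \<in> B \<ominus>\<^sub>r adj J"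
    unfolding mem_rel_minus using w j by (intro exI[of _ \<psi>] exI[of _ j]) (simp add: \<psi>_def)
  have w_A: "(w, t - j) \<in> Am \<ominus>\<^sub>r adj J"
    unfolding mem_rel_minus using t j by blast
  \<comment> \<open>The resolvent is applied to the defect \<open>k - z w\<close>, so that
    \<open>H_IBC\<close> on \<open>r\<close> removes it from the sum.\<close>
  obtain r b where "(k - z *\<^sub>C w, r) \<in> resolvent z (H_IBC Lm B Am J)" and r_A: "(r, b) \<in> Am \<ominus>\<^sub>r adj J"
    using H_IBC_trace_total[OF z(2)] by blast
  then have r: "(r, z *\<^sub>C r - (k - z *\<^sub>C w)) \<in> H_IBC Lm B Am J"
    by (simp add: mem_resolvent)
  define f where "f = w + r"
  have "(w + r, k + (z *\<^sub>C r - (k - z *\<^sub>C w))) \<in> H_max Lm B Am J"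
    by (rule linear_relation_add[OF linear_relations(1) k H_IBC_subset(1)[OF r]])
  then have f: "(f, z *\<^sub>C f) \<in> H_max Lm B Am J"
    by (simp add: f_def scaleC_add_right algebra_simps)
  have f_B: "(f, \<phi>) \<in> B \<ominus>\<^sub>r adj J"
    using linear_relation_add[OF linear_relations(2) w_B H_IBC_subset(2)[OF r]] by (simp add: f_def)
  have f_A: "(f, t - j + b) \<in> Am \<ominus>\<^sub>r adj J"
    unfolding f_def by (rule linear_relation_add[OF linear_relations(3) w_A r_A])
  \<comment> \<open>Elements of the domain of \<open>H_IBC\<close> have zero trace under
    \<open>B - J*\<close>, so one boundary term drops out; the terms in \<open>z\<close> cancel
    because \<open>z\<close> is real.\<close>
  have "cinner \<phi> v = cinner f u"
    if "(u, g) \<in> resolvent z (H_IBC Lm B Am J)" and g_A: "(g, v) \<in> Am \<ominus>\<^sub>r adj J" for u g v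
  proof -
    have g: "(g, z *\<^sub>C g - u) \<in> H_IBC Lm B Am J"
      using that by (simp add: mem_resolvent)
    show ?thesis
      using green_H_max[OF z(1) f f_B f_A H_IBC_subset(1,2)[OF g] g_A]
      by (simp add: cinner_linear cnj)
  qed
  then have "(\<phi>, f) \<in> F_op Lm B Am J z"
    using \<phi> unfolding F_op_def mem_rel_restrict mem_adj cnj by blast
  then show ?thesis
    using f f_B by blast
qed

section \<open>Self-adjointness and the resolvent formula\<close>

text \<open>The formula \<open>?K\<close> is contained in the resolvent and is defined everywhere.
  This makes \<open>z - H\<close> surjective, so the criterion for symmetric relations applies, and
  a total relation inside a single-valued one equals it.\<close>

lemma resolvent_H_rel:
  assumes cond: "ibc_condition Lm B Am J z" and real: "z \<in> \<real>"
    and R: "linear_relation R" "symmetric_relation R"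
    and ran: "Range (adj (F_op Lm B Am J z)) \<subseteq> Range (R \<ominus>\<^sub>r S_op Lm B Am J z)"
  shows "selfadjoint_relation (H_rel Lm B Am J R)"
    and "z \<in> resolvent_set (H_rel Lm B Am J R)"
    and "resolvent z (H_rel Lm B Am J R) =
      (Id \<oplus>\<^sub>r F_op Lm B Am J z \<odot>\<^sub>r (R \<ominus>\<^sub>r S_op Lm B Am J z)\<inverse> \<odot>\<^sub>r (Am \<ominus>\<^sub>r adj J))
        \<odot>\<^sub>r resolvent z (H_IBC Lm B Am J)" (is "_ = ?K")
proof -
  have cnj: "cnj z = z"
    using real Reals_cnj_iff by blast
  have z: "z \<in> resolvent_set (L_op Lm B)" "z \<in> resolvent_set (H_IBC Lm B Am J)"
    using cond by (auto simp: ibc_condition_def)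
  have F_sv: "single_valued (F_op Lm B Am J z)"
    using single_valued_F_op z(2) by (simp add: cnj)
  have K_subset: "?K \<subseteq> resolvent z (H_rel Lm B Am J R)"
  proof (rule subrelI)
    fix u f assume "(u, f) \<in> ?K"
    then obtain g p v \<phi> where g: "(u, g) \<in> resolvent z (H_IBC Lm B Am J)"
      and f: "f = g + p" and v: "(g, v) \<in> Am \<ominus>\<^sub>r adj J"
      and \<phi>: "(\<phi>, v) \<in> R \<ominus>\<^sub>r S_op Lm B Am J z" and p: "(\<phi>, p) \<in> F_op Lm B Am J z"
      by (auto simp: mem_rel_plus)
    obtain \<eta> s where \<eta>: "v = \<eta> - s" "(\<phi>, \<eta>) \<in> R" "(\<phi>, s) \<in> S_op Lm B Am J z"
      using \<phi> by (auto simp: mem_rel_minus)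
    \<comment> \<open>The product defining \<open>S_op\<close> hides a value of \<open>F\<close> at
      \<open>\<phi>\<close>; single-valuedness identifies it with \<open>p\<close>.\<close>
    have s: "(p, s) \<in> Am \<ominus>\<^sub>r adj J"
      using \<eta>(3) p single_valuedD[OF F_sv] unfolding S_op_def by blast
    have "\<phi> \<in> Domain (T_op Lm B Am z)"
      using p by (simp add: F_op_def mem_rel_restrict)
    then have pH: "(p, z *\<^sub>C p) \<in> H_max Lm B Am J" "(p, \<phi>) \<in> B \<ominus>\<^sub>r adj J"
      using F_op_solves[OF cond real] p single_valuedD[OF F_sv] by blast+
    have gH: "(g, z *\<^sub>C g - u) \<in> H_IBC Lm B Am J"
      using g by (simp add: mem_resolvent)
    have "(g + p, z *\<^sub>C g - u + z *\<^sub>C p) \<in> H_max Lm B Am J"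
      by (rule linear_relation_add[OF linear_relations(1) H_IBC_subset(1)[OF gH] pH(1)])
    moreover have "(g + p, 0 + \<phi>) \<in> B \<ominus>\<^sub>r adj J"
      by (rule linear_relation_add[OF linear_relations(2) H_IBC_subset(2)[OF gH] pH(2)])
    \<comment> \<open>Here \<open>v + s = \<eta>\<close>, so the two boundary values of
      \<open>g + p\<close> are \<open>\<phi>\<close> and \<open>\<eta>\<close>, a pair in
      \<open>R\<close>.\<close>
    moreover have "(g + p, v + s) \<in> Am \<ominus>\<^sub>r adj J"
      by (rule linear_relation_add[OF linear_relations(3) v s])
    ultimately show "(u, f) \<in> resolvent z (H_rel Lm B Am J R)"
      unfolding mem_resolvent mem_H_rel using \<eta> by (auto simp: f scaleC_add_right algebra_simps)
  qed
  have K_total: "\<exists>f. (u, f) \<in> ?K" for u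
  proof -
    obtain g v where g: "(u, g) \<in> resolvent z (H_IBC Lm B Am J)" and v: "(g, v) \<in> Am \<ominus>\<^sub>r adj J"
      using H_IBC_trace_total[OF z(2)] by blast
    then have "(u, v) \<in> adj (F_op Lm B Am J z)"
      using F_op_adjoint[of z] by (auto simp: cnj)
    then obtain \<phi> where \<phi>: "(\<phi>, v) \<in> R \<ominus>\<^sub>r S_op Lm B Am J z"
      using ran by blast
    \<comment> \<open>Membership in the difference forces \<open>\<phi>\<close> into the domain of
      \<open>S_op\<close>, hence into that of \<open>F_op\<close>.\<close>
    then obtain p where "(\<phi>, p) \<in> F_op Lm B Am J z"
      by (auto simp: mem_rel_minus S_op_def)
    then have "(g, g + p) \<in> Id \<oplus>\<^sub>r F_op Lm B Am J z \<odot>\<^sub>r (R \<ominus>\<^sub>r S_op Lm B Am J z)\<inverse> \<odot>\<^sub>r (Am \<ominus>\<^sub>r adj J)"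
      unfolding mem_rel_plus using v \<phi> by blast
    then show ?thesis
      using g by blast
  qed
  have surj: "Domain (resolvent z (H_rel Lm B Am J R)) = UNIV"
    using K_subset K_total by blast
  note H = symmetric_relation_surjective[OF linear_relation_H_rel[OF R(1)]
      symmetric_relation_H_rel[OF z(1) R(2)] real surj]
  show "selfadjoint_relation (H_rel Lm B Am J R)" "z \<in> resolvent_set (H_rel Lm B Am J R)"
    by (fact H)+
  show "resolvent z (H_rel Lm B Am J R) = ?K"
  proof (rule equalityI[OF subrelI K_subset])
    fix u f assume f: "(u, f) \<in> resolvent z (H_rel Lm B Am J R)"
    obtain f' where f': "(u, f') \<in> ?K"
      using K_total by blast
    then have "f' = f"
      using K_subset f single_valuedD[OF single_valued_resolvent[OF H(2)]] by (meson subsetD)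
    with f' show "(u, f) \<in> ?K"
      by (simp only:)
  qed
qed

end

theorem theorem4p9:
  fixes Lm :: "('h::chilbert_space \<times> 'h) set"
    and B Am :: "('h \<times> 'd::chilbert_space) set"
    and J :: "('d \<times> 'h) set"
    and R :: "('d \<times> 'd) set"
  assumes "ibc_setting Lm B Am J"
    and "\<exists>z. ibc_condition Lm B Am J z"
    and "linear_relation R"
    and "symmetric_relation R"
  shows "symmetric_relation (H_rel Lm B Am J R) \<and>
    (\<forall>z\<in>\<real>. ibc_condition Lm B Am J z \<and>
        one_to_one (R \<ominus>\<^sub>r S_op Lm B Am J z) \<and>
        Range (adj (F_op Lm B Am J z)) \<subseteq> Range (R \<ominus>\<^sub>r S_op Lm B Am J z) \<longrightarrow>
      selfadjoint_relation (H_rel Lm B Am J R) \<and>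
      z \<in> resolvent_set (H_rel Lm B Am J R) \<and>
      resolvent z (H_rel Lm B Am J R) =
        (Id \<oplus>\<^sub>r F_op Lm B Am J z \<odot>\<^sub>r (R \<ominus>\<^sub>r S_op Lm B Am J z)\<inverse> \<odot>\<^sub>r (Am \<ominus>\<^sub>r adj J))
          \<odot>\<^sub>r resolvent z (H_IBC Lm B Am J))"
proof -
  interpret ibc_setting Lm B Am J
    by (rule assms(1))
  \<comment> \<open>Any point of the resolvent set of \<open>L\<close> makes Green's identity
    available.\<close>
  obtain z where "z \<in> resolvent_set (L_op Lm B)"
    using assms(2) by (auto simp: ibc_condition_def)
  then have "symmetric_relation (H_rel Lm B Am J R)"
    using assms(4) by (rule symmetric_relation_H_rel)
  then show ?thesis
    using resolvent_H_rel[OF _ _ assms(3,4)] by blast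
qed

end
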